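(* For every integer $k\ge 1$ and every finite graph $H$ with no isolated vertices, $\gamma_t(Q_{2^k}\times H)=2^{2^k-k}\,\gamma_t(H)$.
   Context: Graphs are finite, simple and undirected. A set $D\subseteq V(G)$ is a total dominating set of a graph $G$ if every vertex of $G$ has a neighbor in $D$; the total domination number $\gamma_t(G)$ is the minimum cardinality of a total dominating set of $G$ (defined for graphs with no isolated vertices). $Q_n$ is the $n$-dimensional hypercube: its vertices are the binary strings of length $n$, and two are adjacent if they differ in exactly one coordinate. The direct product $G\times H$ has vertex set $V(G)\times V(H)$, with $(g_1,h_1)$ and $(g_2,h_2)$ adjacent if $g_1g_2\in E(G)$ and $h_1h_2\in E(H)$. *)

theory Defs
  imports "Graph_Theory.Pair_Digraph"
begin

text \<open>
  A finite simple undirected graph is a \<open>pair_graph\<close>: a finite vertex set \<open>pverts G\<close> with a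
  symmetric, loop-free adjacency relation \<open>parcs G\<close>, each edge occurring as two arcs.
\<close>

definition no_isolated_vertices :: "'a pair_pre_digraph \<Rightarrow> bool" where
  "no_isolated_vertices G \<longleftrightarrow> (\<forall>v\<in>pverts G. \<exists>u\<in>pverts G. (v, u) \<in> parcs G)"

definition total_dominating_set :: "'a pair_pre_digraph \<Rightarrow> 'a set \<Rightarrow> bool" where
  "total_dominating_set G D \<longleftrightarrow>
     D \<subseteq> pverts G \<and> (\<forall>v\<in>pverts G. \<exists>u\<in>D. (v, u) \<in> parcs G)"

text \<open>
  Only meaningful for finite graphs without isolated vertices, where the minimum ranges over a
  finite nonempty set (lemma \<open>total_dominating_set_cards\<close> below).
\<close>

definition total_domination_number :: "'a pair_pre_digraph \<Rightarrow> nat" (\<open>\<gamma>\<^sub>t\<close>) where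
  "\<gamma>\<^sub>t G = Min (card ` {D. total_dominating_set G D})"

definition hypercube :: "nat \<Rightarrow> bool list pair_pre_digraph" where
  "hypercube n =
     \<lparr> pverts = {x. length x = n},
       parcs = {(x, y). length x = n \<and> length y = n \<and> card {i. i < n \<and> x ! i \<noteq> y ! i} = 1} \<rparr>"

definition direct_product ::
  "'a pair_pre_digraph \<Rightarrow> 'b pair_pre_digraph \<Rightarrow> ('a \<times> 'b) pair_pre_digraph" where
  "direct_product G H =
     \<lparr> pverts = pverts G \<times> pverts H,
       parcs = {((g1, h1), (g2, h2)). (g1, g2) \<in> parcs G \<and> (h1, h2) \<in> parcs H} \<rparr>"

lemma total_dominating_set_cards:
  assumes "pair_graph G" and "no_isolated_vertices G"
  shows "finite (card ` {D. total_dominating_set G D})"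
    and "card ` {D. total_dominating_set G D} \<noteq> {}"
proof -
  have fin: "finite (pverts G)"
    using assms(1) by (simp add: pair_graph_def pair_digraph_def
        pair_fin_digraph_def pair_fin_digraph_axioms_def)
  have "{D. total_dominating_set G D} \<subseteq> Pow (pverts G)"
    by (auto simp: total_dominating_set_def)
  with fin show "finite (card ` {D. total_dominating_set G D})"
    by (meson finite_Pow_iff finite_imageI finite_subset)
  have "total_dominating_set G (pverts G)"
    using assms(2) by (auto simp: total_dominating_set_def no_isolated_vertices_def)
  then show "card ` {D. total_dominating_set G D} \<noteq> {}"
    by auto
qed

lemma pair_graph_iff:
  "pair_graph G \<longleftrightarrow> finite (pverts G) \<and> parcs G \<subseteq> pverts G \<times> pverts G \<and>
     sym (parcs G) \<and> irrefl (parcs G)" (is "?L \<longleftrightarrow> ?R")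
proof
  assume ?L
  then interpret pair_graph G .
  show ?R
    using pair_finite_verts pair_sym_arcs pair_no_loops arc_fst_in_verts arc_snd_in_verts
    by (force simp: symmetric_def irrefl_def)
next
  assume R: ?R
  then have "finite (parcs G)"
    by (meson finite_SigmaI finite_subset)
  with R show ?L
    by unfold_locales (auto simp: symmetric_def irrefl_def)
qed

lemma pair_graph_hypercube: "pair_graph (hypercube n)"
proof -
  have "finite {x :: bool list. length x = n}"
    using finite_lists_length_eq[of "UNIV :: bool set" n] by simp
  moreover have "{i. i < n \<and> x ! i \<noteq> y ! i} = {i. i < n \<and> y ! i \<noteq> x ! i}" for x y :: "bool list"
    by auto
  ultimately show ?thesis
    unfolding pair_graph_iff by (auto simp: hypercube_def sym_def irrefl_def)
qed

lemma pair_graph_direct_product: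
  assumes "pair_graph G" and "pair_graph H"
  shows "pair_graph (direct_product G H)"
  using assms unfolding pair_graph_iff
  by (auto simp: direct_product_def sym_def irrefl_def)

lemma no_isolated_vertices_hypercube:
  assumes "n \<ge> 1"
  shows "no_isolated_vertices (hypercube n)"
proof -
  have "card {i. i < n \<and> x ! i \<noteq> x[0 := \<not> x ! 0] ! i} = 1" if "length x = n" for x :: "bool list"
  proof -
    have "{i. i < n \<and> x ! i \<noteq> x[0 := \<not> x ! 0] ! i} = {0}"
      using assms that by (auto simp: nth_list_update)
    then show ?thesis by simp
  qed
  then show ?thesis
    unfolding no_isolated_vertices_def hypercube_def
    by (auto intro!: exI[of _ "_[0 := _]"])
qed

lemma no_isolated_vertices_direct_product:
  assumes "no_isolated_vertices G" and "no_isolated_vertices H"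
  shows "no_isolated_vertices (direct_product G H)"
  using assms by (fastforce simp: no_isolated_vertices_def direct_product_def)

end

theory Submission
  imports Defs
begin

text \<open>
  The Hamming code, read as the set of words of length \<open>2 ^ k\<close> whose syndrome (the bitwise sum of
  the positions of its ones) vanishes, is a \<^emph>\<open>perfect\<close> total dominating set \<open>D\<close>
  of the hypercube: every vertex has exactly one neighbour in \<open>D\<close>. So the open neighbourhoods of
  the points of \<open>D\<close> partition the vertices. Inside each block \<open>N(d) \<times> V(H)\<close>, any total dominating
  set of the product has at least \<open>\<gamma>\<^sub>t H\<close> vertices, since its projection to \<open>H\<close> is total dominating
  (look at the neighbours of \<open>(d, h)\<close>). Conversely \<open>D \<times> S\<close> is total dominating whenever
  \<open>S\<close> is.
\<close>

lemma total_dominating_set_imp_no_isolated_vertices: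
  "total_dominating_set G D \<Longrightarrow> no_isolated_vertices G"
  unfolding total_dominating_set_def no_isolated_vertices_def by blast

lemma total_domination_number_le:
  assumes "pair_graph G" and "total_dominating_set G D"
  shows "\<gamma>\<^sub>t G \<le> card D"
proof -
  have "no_isolated_vertices G"
    using assms(2) by (rule total_dominating_set_imp_no_isolated_vertices)
  from total_dominating_set_cards(1)[OF assms(1) this] assms(2) show ?thesis
    unfolding total_domination_number_def by (auto intro: Min_le)
qed

lemma total_domination_number_attained:
  assumes "pair_graph G" and "no_isolated_vertices G"
  obtains D where "total_dominating_set G D" and "card D = \<gamma>\<^sub>t G"
  using Min_in[OF total_dominating_set_cards[OF assms]]
  unfolding total_domination_number_def by auto

definition perfect_total_dominating_set :: "'a pair_pre_digraph \<Rightarrow> 'a set \<Rightarrow> bool" where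
  "perfect_total_dominating_set G D \<longleftrightarrow>
     D \<subseteq> pverts G \<and> (\<forall>v\<in>pverts G. \<exists>!u. u \<in> D \<and> (v, u) \<in> parcs G)"

lemma perfect_total_dominating_set_imp_total_dominating_set:
  "perfect_total_dominating_set G D \<Longrightarrow> total_dominating_set G D"
  unfolding perfect_total_dominating_set_def total_dominating_set_def by blast

lemma total_dominating_set_times:
  assumes "total_dominating_set G D" and "total_dominating_set H S"
  shows "total_dominating_set (direct_product G H) (D \<times> S)"
  using assms by (fastforce simp: total_dominating_set_def direct_product_def)

text \<open>By symmetry of \<open>parcs G\<close>, a common neighbour of \<open>c\<close> and
  \<open>d\<close> would have two neighbours in \<open>D\<close>, against uniqueness.\<close>

lemma perfect_neighbourhoods_disjoint:
  assumes "pair_graph G" and "perfect_total_dominating_set G D"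
    and "c \<in> D" and "d \<in> D" and "c \<noteq> d"
  shows "parcs G `` {c} \<inter> parcs G `` {d} = {}"
proof (rule ccontr)
  assume "parcs G `` {c} \<inter> parcs G `` {d} \<noteq> {}"
  then obtain v where "(c, v) \<in> parcs G" "(d, v) \<in> parcs G" by auto
  then have "(v, c) \<in> parcs G" "(v, d) \<in> parcs G" "v \<in> pverts G"
    using assms(1) unfolding pair_graph_iff by (auto dest: symD)
  then show False
    using assms(2-5) unfolding perfect_total_dominating_set_def by blast
qed

text \<open>The neighbourhoods of the points of \<open>D\<close> partition the vertices into blocks
  of size \<open>r\<close>. For a regular graph this gives the size of \<open>D\<close> without
  enumerating it.\<close>

lemma card_perfect_total_dominating_set:
  assumes G: "pair_graph G" and D: "perfect_total_dominating_set G D"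
    and regular: "\<And>v. v \<in> pverts G \<Longrightarrow> card (parcs G `` {v}) = r"
  shows "card D * r = card (pverts G)"
proof -
  have fin: "finite (pverts G)" and arcs: "parcs G \<subseteq> pverts G \<times> pverts G" and "sym (parcs G)"
    using G by (auto simp: pair_graph_iff)
  have sub: "D \<subseteq> pverts G"
    using D by (simp add: perfect_total_dominating_set_def)
  have cover: "(\<Union>d\<in>D. parcs G `` {d}) = pverts G"
  proof
    show "pverts G \<subseteq> (\<Union>d\<in>D. parcs G `` {d})"
      using D \<open>sym (parcs G)\<close>
      unfolding perfect_total_dominating_set_def by (blast dest: symD)
  qed (use arcs in auto)
  have "card (\<Union>d\<in>D. parcs G `` {d}) = (\<Sum>d\<in>D. card (parcs G `` {d}))"
  proof (rule card_UN_disjoint)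
    show "finite D"
      using sub fin by (rule finite_subset)
    show "\<forall>d\<in>D. finite (parcs G `` {d})"
      using arcs by (auto intro: finite_subset[OF _ fin])
    show "\<forall>c\<in>D. \<forall>d\<in>D. c \<noteq> d \<longrightarrow> parcs G `` {c} \<inter> parcs G `` {d} = {}"
      using perfect_neighbourhoods_disjoint[OF G D] by blast
  qed
  also have "\<dots> = card D * r"
    using regular sub by (simp add: subset_iff)
  finally show ?thesis
    using cover by simp
qed

lemma total_domination_number_le_card_block:
  assumes H: "pair_graph H" and d: "d \<in> pverts G" and "finite T"
    and T: "total_dominating_set (direct_product G H) T"
  shows "\<gamma>\<^sub>t H \<le> card (T \<inter> parcs G `` {d} \<times> pverts H)"
proof -
  let ?B = "T \<inter> parcs G `` {d} \<times> pverts H"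
  have "total_dominating_set H (snd ` ?B)"
    unfolding total_dominating_set_def
  proof (intro conjI ballI)
    fix h assume "h \<in> pverts H"
    \<comment> \<open>Domination is applied to the vertex \<open>(d, h)\<close>: the first
      coordinate of its neighbour in \<open>T\<close> is forced into the neighbourhood of
      \<open>d\<close>.\<close>
    with T d obtain g' h' where *: "(g', h') \<in> T" "(d, g') \<in> parcs G" "(h, h') \<in> parcs H"
      unfolding total_dominating_set_def direct_product_def by fastforce
    then have "(g', h') \<in> ?B"
      using H by (auto simp: pair_graph_iff)
    with * show "\<exists>u\<in>snd ` ?B. (h, u) \<in> parcs H"
      by force
  qed auto
  then have "\<gamma>\<^sub>t H \<le> card (snd ` ?B)"
    by (rule total_domination_number_le[OF H])
  also have "\<dots> \<le> card ?B"
    using \<open>finite T\<close> by (intro card_image_le) auto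
  finally show ?thesis .
qed

text \<open>The hypercube enters the final result only through a perfect total dominating set and
  its size, so the product formula is proved for any such \<open>G\<close>.\<close>

theorem total_domination_number_direct_product_perfect:
  assumes G: "pair_graph G" and D: "perfect_total_dominating_set G D"
    and H: "pair_graph H" and isol: "no_isolated_vertices H"
  shows "\<gamma>\<^sub>t (direct_product G H) = card D * \<gamma>\<^sub>t H"
proof (rule antisym)
  have GH: "pair_graph (direct_product G H)"
    using G H by (rule pair_graph_direct_product)
  have D': "total_dominating_set G D"
    using D by (rule perfect_total_dominating_set_imp_total_dominating_set)
  obtain S where "total_dominating_set H S" and S: "card S = \<gamma>\<^sub>t H"
    using total_domination_number_attained[OF H isol] .
  then have "total_dominating_set (direct_product G H) (D \<times> S)"
    by (intro total_dominating_set_times D')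
  then show "\<gamma>\<^sub>t (direct_product G H) \<le> card D * \<gamma>\<^sub>t H"
    using total_domination_number_le[OF GH] S by (metis card_cartesian_product)
  have "no_isolated_vertices G"
    using D' by (rule total_dominating_set_imp_no_isolated_vertices)
  then have "no_isolated_vertices (direct_product G H)"
    using isol by (rule no_isolated_vertices_direct_product)
  then obtain T where T: "total_dominating_set (direct_product G H) T"
    and cT: "card T = \<gamma>\<^sub>t (direct_product G H)"
    by (rule total_domination_number_attained[OF GH])
  have sub: "D \<subseteq> pverts G"
    using D by (simp add: perfect_total_dominating_set_def)
  have "finite D"
    using G sub by (auto simp: pair_graph_iff intro: finite_subset)
  have "finite T"
    using T GH by (auto simp: pair_graph_iff total_dominating_set_def intro: finite_subset)
  let ?B = "\<lambda>d. T \<inter> parcs G `` {d} \<times> pverts H"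
  have "card D * \<gamma>\<^sub>t H = (\<Sum>d\<in>D. \<gamma>\<^sub>t H)"
    by simp
  also have "\<dots> \<le> (\<Sum>d\<in>D. card (?B d))"
    using total_domination_number_le_card_block[OF H _ \<open>finite T\<close> T] sub
    by (intro sum_mono) blast
  also have "\<dots> = card (\<Union>d\<in>D. ?B d)"
  proof (rule card_UN_disjoint[symmetric])
    show "\<forall>c\<in>D. \<forall>d\<in>D. c \<noteq> d \<longrightarrow> ?B c \<inter> ?B d = {}"
      using perfect_neighbourhoods_disjoint[OF G D] by blast
  qed (use \<open>finite D\<close> \<open>finite T\<close> in auto)
  also have "\<dots> \<le> card T"
    using \<open>finite T\<close> by (intro card_mono) auto
  finally show "card D * \<gamma>\<^sub>t H \<le> \<gamma>\<^sub>t (direct_product G H)"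
    using cT by simp
qed

text \<open>Neighbours become single flips indexed by a position, the form in which
  \<open>syndrome_flip\<close> applies.\<close>

lemma parcs_hypercube_iff:
  "(x, y) \<in> parcs (hypercube n) \<longleftrightarrow> length x = n \<and> (\<exists>i<n. y = x[i := \<not> x ! i])"
proof
  assume "(x, y) \<in> parcs (hypercube n)"
  then have len: "length x = n" "length y = n" and "card {i. i < n \<and> x ! i \<noteq> y ! i} = 1"
    by (auto simp: hypercube_def)
  then obtain i where i: "{i. i < n \<and> x ! i \<noteq> y ! i} = {i}"
    by (auto simp: card_1_singleton_iff)
  then have "i < n" "x ! i \<noteq> y ! i" and "\<forall>j<n. j \<noteq> i \<longrightarrow> x ! j = y ! j"
    by auto
  then have "y = x[i := \<not> x ! i]"
    using len by (intro nth_equalityI) (auto simp: nth_list_update)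
  with len \<open>i < n\<close> show "length x = n \<and> (\<exists>i<n. y = x[i := \<not> x ! i])"
    by blast
next
  assume "length x = n \<and> (\<exists>i<n. y = x[i := \<not> x ! i])"
  then obtain i where *: "length x = n" "i < n" "y = x[i := \<not> x ! i]" by blast
  then have "{j. j < n \<and> x ! j \<noteq> y ! j} = {i}"
    by (auto simp: nth_list_update split: if_splits)
  with * show "(x, y) \<in> parcs (hypercube n)"
    by (simp add: hypercube_def)
qed

lemma hypercube_regular:
  assumes "x \<in> pverts (hypercube n)"
  shows "card (parcs (hypercube n) `` {x}) = n"
proof -
  have len: "length x = n"
    using assms by (simp add: hypercube_def)
  have "parcs (hypercube n) `` {x} = (\<lambda>i. x[i := \<not> x ! i]) ` {..<n}"
    using len by (auto simp: parcs_hypercube_iff)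
  \<comment> \<open>Flips at distinct positions \<open>i\<close> and \<open>j\<close> disagree at
    \<open>i\<close>: only the first changes \<open>x ! i\<close>.\<close>
  moreover have "inj_on (\<lambda>i. x[i := \<not> x ! i]) {..<n}"
    by (rule inj_onI) (metis len lessThan_iff nth_list_update_eq nth_list_update_neq)
  ultimately show ?thesis
    by (simp add: card_image)
qed

lemma card_pverts_hypercube: "card (pverts (hypercube n)) = 2 ^ n"
  using card_lists_length_eq[of "UNIV :: bool set" n] by (simp add: hypercube_def)

unbundle bit_operations_syntax

text \<open>The bitwise sum of the positions of the ones, where positions are counted from \<open>m\<close>.\<close>

fun syndrome :: "nat \<Rightarrow> bool list \<Rightarrow> nat" where
  "syndrome m [] = 0"
| "syndrome m (b # bs) = (if b then m else 0) XOR syndrome (Suc m) bs"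

text \<open>A flip adds or removes the summand \<open>m + i\<close>, and under XOR these are the
  same operation. The offset \<open>m\<close> must vary in the induction, as the tail counts from
  \<open>Suc m\<close>.\<close>

lemma syndrome_flip:
  "i < length x \<Longrightarrow> syndrome m (x[i := \<not> x ! i]) = syndrome m x XOR (m + i)"
proof (induction x arbitrary: i m)
  case (Cons b x)
  show ?case
  proof (cases i)
    case 0
    have cancel: "m XOR (m XOR s) = s" for s
      by (simp flip: xor.assoc)
    from 0 show ?thesis by (simp add: ac_simps cancel)
  next
    case (Suc j)
    then show ?thesis using Cons by (simp add: ac_simps)
  qed
qed simp

text \<open>The numbers below \<open>2 ^ k\<close> are those fixed by \<open>take_bit k\<close>,
  which commutes with XOR.\<close>

lemma xor_nat_less_power_two:
  fixes a b :: nat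
  assumes "a < 2 ^ k" and "b < 2 ^ k"
  shows "a XOR b < 2 ^ k"
  using assms by (metis take_bit_nat_eq_self take_bit_nat_less_exp take_bit_xor)

text \<open>All positions summed are below \<open>2 ^ k\<close>. For words of length
  \<open>2 ^ k\<close> counted from \<open>0\<close>, the syndrome is therefore itself a valid
  position.\<close>

lemma syndrome_less:
  "m + length x \<le> 2 ^ k \<Longrightarrow> syndrome m x < 2 ^ k"
  by (induction x arbitrary: m) (auto intro!: xor_nat_less_power_two)

text \<open>For \<open>n = 2 ^ k\<close> this is the classical Hamming code of length
  \<open>2 ^ k - 1\<close> with a free bit in front, since position \<open>0\<close> contributes
  nothing to the syndrome.\<close>

definition hamming_code :: "nat \<Rightarrow> bool list set" where
  "hamming_code n = {x. length x = n \<and> syndrome 0 x = 0}"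

text \<open>
  Positions count from \<open>0\<close>, and flipping position \<open>0\<close> leaves the syndrome unchanged. Hence a
  codeword, too, has a neighbour in the code, as total (rather than ordinary) domination requires.
\<close>

lemma perfect_total_dominating_set_hamming_code:
  "perfect_total_dominating_set (hypercube (2 ^ k)) (hamming_code (2 ^ k))"
  unfolding perfect_total_dominating_set_def
proof (intro conjI ballI)
  show "hamming_code (2 ^ k) \<subseteq> pverts (hypercube (2 ^ k))"
    by (auto simp: hamming_code_def hypercube_def)
next
  fix x assume "x \<in> pverts (hypercube (2 ^ k))"
  then have len: "length x = 2 ^ k" by (simp add: hypercube_def)
  let ?s = "syndrome 0 x"
  have s: "?s < 2 ^ k"
    by (rule syndrome_less) (simp add: len)
  \<comment> \<open>Flipping \<open>i\<close> changes the syndrome to \<open>?s XOR i\<close>, so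
    exactly one flip, at the position named by the syndrome, reaches the code.\<close>
  have flip: "syndrome 0 (x[i := \<not> x ! i]) = 0 \<longleftrightarrow> i = ?s" if "i < 2 ^ k" for i
  proof -
    have "?s XOR i = 0 \<longleftrightarrow> i = ?s"
      by (metis xor.assoc xor.left_neutral xor.right_neutral xor_self_eq)
    then show ?thesis using that by (simp add: syndrome_flip len)
  qed
  show "\<exists>!u. u \<in> hamming_code (2 ^ k) \<and> (x, u) \<in> parcs (hypercube (2 ^ k))"
  proof (rule ex1I)
    show "x[?s := \<not> x ! ?s] \<in> hamming_code (2 ^ k)
        \<and> (x, x[?s := \<not> x ! ?s]) \<in> parcs (hypercube (2 ^ k))"
      using s flip len by (auto simp: hamming_code_def parcs_hypercube_iff)
  next
    fix u assume "u \<in> hamming_code (2 ^ k) \<and> (x, u) \<in> parcs (hypercube (2 ^ k))"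
    then show "u = x[?s := \<not> x ! ?s]"
      using flip by (auto simp: hamming_code_def parcs_hypercube_iff)
  qed
qed

lemma card_hamming_code: "card (hamming_code (2 ^ k)) = 2 ^ (2 ^ k - k)"
proof -
  have "card (hamming_code (2 ^ k)) * 2 ^ k = 2 ^ 2 ^ k"
    using card_perfect_total_dominating_set[OF pair_graph_hypercube
        perfect_total_dominating_set_hamming_code hypercube_regular]
    by (simp add: card_pverts_hypercube)
  \<comment> \<open>The truncated subtraction is exact because \<open>k < 2 ^ k\<close>.\<close>
  also have "\<dots> = 2 ^ (2 ^ k - k) * 2 ^ k"
    by (metis le_add_diff_inverse2 less_exp less_imp_le power_add)
  finally show ?thesis by simp
qed

theorem mainTheorem4:
  fixes k :: nat and H :: "'a pair_pre_digraph"
  assumes "k \<ge> 1"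
    and "pair_graph H"
    and "no_isolated_vertices H"
  shows "\<gamma>\<^sub>t (direct_product (hypercube (2 ^ k)) H) = 2 ^ (2 ^ k - k) * \<gamma>\<^sub>t H"
  using total_domination_number_direct_product_perfect[OF pair_graph_hypercube
      perfect_total_dominating_set_hamming_code assms(2,3)]
  by (simp add: card_hamming_code)

end
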